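(* Let $N$ be a positive integer and let $\alpha,\beta,\zeta$ be real parameters that are generic (no denominator appearing below or in the context vanishes). Write $\mathcal U_m(n)=\mathcal U_m(n;\alpha,\beta,\zeta,N)$ as defined in the context, and put $$\mathcal A_m=\frac{(m-N)(m+N-2\alpha-\beta-2\zeta)(m-2\beta-2\zeta-1)}{(2m-2\beta-2\zeta-1)(2m-2\beta-2\zeta)},$$ $$\mathcal C_m=-\frac{m(m+2\alpha-\beta-N-1)(m-2\beta-2\zeta+N-1)}{(2m-2\beta-2\zeta-2)(2m-2\beta-2\zeta-1)}.$$ Then for all $m,n\in\{0,\dots,N\}$ $$n\Big(\mathcal A_m\,\mathcal U_{m+1}(n)-(\mathcal A_m+\mathcal C_m+\alpha)\,\mathcal U_m(n)+\mathcal C_m\,\mathcal U_{m-1}(n)\Big)$$ $$=(m+\alpha-\beta)\mathcal A_m\,\mathcal U_{m+1}(n)-\Big((m+\alpha-\beta)\mathcal A_m-(m-\alpha-\beta-2\zeta-1)\mathcal C_m\Big)\mathcal U_m(n)-(m-\alpha-\beta-2\zeta-1)\mathcal C_m\,\mathcal U_{m-1}(n).$$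
   Context: Notation: $(a)_n=a(a+1)\cdots(a+n-1)$, $(a)_0=1$, and $(a_1,\dots,a_k)_n=(a_1)_n\cdots(a_k)_n$. For $m,n\in\{0,\dots,N\}$, $$\mathcal U_m(n;a,b,c,N)={}_4F_3\left({-m,\ -n,\ -a,\ m-2b-2c-1\atop -N,\ a-b-n,\ N-2a-b-2c};1\right)=\sum_{\ell=0}^{\min(m,n)}\frac{(-m,-n,-a,m-2b-2c-1)_\ell}{\ell!\,(-N,a-b-n,N-2a-b-2c)_\ell}.$$ Since $\mathcal C_0=0$ and $\mathcal A_N=0$, the terms involving $\mathcal U_{-1}(n)$ and $\mathcal U_{N+1}(n)$ are understood to be zero. *)

theory Defs
  imports Complex_Main
begin

definition U_den :: "nat \<Rightarrow> nat \<Rightarrow> real \<Rightarrow> real \<Rightarrow> real \<Rightarrow> nat \<Rightarrow> real" where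
  "U_den l n a b c N =
     fact l * (pochhammer (- real N) l * pochhammer (a - b - real n) l
               * pochhammer (real N - 2*a - b - 2*c) l)"

text \<open>
  The terminating series 4F3 with upper parameters \<open>-m, -n, -a, m - 2b - 2c - 1\<close> and lower
  parameters \<open>-N, a - b - n, N - 2a - b - 2c\<close> at argument 1. The summation stops at
  \<open>min m n\<close>, since \<open>-N\<close> is itself a lower parameter. The degree \<open>m\<close> is an integer, and
  degrees outside \<open>{0..N}\<close> give 0: this is the convention for the terms with
  \<open>U (-1)\<close> and \<open>U (N + 1)\<close>, whose coefficients vanish.
\<close>

definition U :: "int \<Rightarrow> nat \<Rightarrow> real \<Rightarrow> real \<Rightarrow> real \<Rightarrow> nat \<Rightarrow> real" where
  "U m n a b c N =
     (if 0 \<le> m \<and> m \<le> int N then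
        (\<Sum>l = 0..min (nat m) n.
           (pochhammer (- real_of_int m) l * pochhammer (- real n) l * pochhammer (- a) l
             * pochhammer (real_of_int m - 2*b - 2*c - 1) l)
           / U_den l n a b c N)
      else 0)"

definition A_den :: "nat \<Rightarrow> real \<Rightarrow> real \<Rightarrow> real" where
  "A_den m \<beta> \<zeta> = (2 * real m - 2*\<beta> - 2*\<zeta> - 1) * (2 * real m - 2*\<beta> - 2*\<zeta>)"

definition A_coeff :: "nat \<Rightarrow> real \<Rightarrow> real \<Rightarrow> real \<Rightarrow> nat \<Rightarrow> real" where
  "A_coeff m \<alpha> \<beta> \<zeta> N =
     (real m - real N) * (real m + real N - 2*\<alpha> - \<beta> - 2*\<zeta>) * (real m - 2*\<beta> - 2*\<zeta> - 1)
     / A_den m \<beta> \<zeta>"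

definition C_den :: "nat \<Rightarrow> real \<Rightarrow> real \<Rightarrow> real" where
  "C_den m \<beta> \<zeta> = (2 * real m - 2*\<beta> - 2*\<zeta> - 2) * (2 * real m - 2*\<beta> - 2*\<zeta> - 1)"

definition C_coeff :: "nat \<Rightarrow> real \<Rightarrow> real \<Rightarrow> real \<Rightarrow> nat \<Rightarrow> real" where
  "C_coeff m \<alpha> \<beta> \<zeta> N =
     - (real m * (real m + 2*\<alpha> - \<beta> - real N - 1) * (real m - 2*\<beta> - 2*\<zeta> + real N - 1)
        / C_den m \<beta> \<zeta>)"

definition generic_parameters :: "real \<Rightarrow> real \<Rightarrow> real \<Rightarrow> nat \<Rightarrow> bool" where
  "generic_parameters \<alpha> \<beta> \<zeta> N \<longleftrightarrow>
     (\<forall>m\<le>N. A_den m \<beta> \<zeta> \<noteq> 0 \<and> C_den m \<beta> \<zeta> \<noteq> 0) \<and>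
     (\<forall>m\<le>N. \<forall>n\<le>N. \<forall>l\<le>min m n. U_den l n \<alpha> \<beta> \<zeta> N \<noteq> 0)"

end

theory Submission
  imports Defs
begin

text \<open>
  Put \<open>\<sigma> = 2\<beta> + 2\<zeta> + 1\<close>, \<open>D = N - 2\<alpha> - \<beta> - 2\<zeta>\<close>, \<open>e = n - \<alpha> + \<beta>\<close>, \<open>p = m\<close> and \<open>q = \<sigma> - m\<close>.
  Everything is governed by the symmetry \<open>p \<leftrightarrow> q\<close>: the \<open>m\<close>-dependence of the \<open>l\<close>-th term of the series
  is \<open>(-p)\<^sub>l (-q)\<^sub>l\<close>, replacing \<open>m\<close> by \<open>m + 1\<close> means \<open>(p, q) \<mapsto> (p + 1, q - 1)\<close>, and the two
  coefficients \<open>A\<close> and \<open>C\<close> are the values at \<open>(p, q)\<close> and \<open>(q, p)\<close> of one function. In these terms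
  the claim reads
  \<open>A (e - p) (u\<^bsub>m+1\<^esub> - u\<^sub>m) + C (e - q) (u\<^bsub>m-1\<^esub> - u\<^sub>m) = \<alpha> n u\<^sub>m\<close>.

  On the products \<open>(-p)\<^sub>l (-q)\<^sub>l\<close>, each of the two weighted differences is an explicit multiple of
  \<open>(-p)\<^bsub>l-1\<^esub> (-q)\<^bsub>l-1\<^esub> / (p - q)\<close> (lemma \<open>weighted_upward_difference\<close>). Their sum, with the factors
  \<open>e - p\<close> and \<open>e - q\<close> inserted, has a numerator antisymmetric in \<open>p\<close> and \<open>q\<close>, so \<open>p - q\<close> cancels;
  what is left is a combination of the products with indices \<open>l\<close> and \<open>l - 1\<close>
  (lemma \<open>difference_operator_on_basis\<close>). The operator is thus bidiagonal in this basis, and the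
  two-term recurrence of the hypergeometric coefficients says exactly that the resulting sum over
  \<open>l\<close> telescopes to zero (lemma \<open>difference_equation_of_series\<close>).
\<close>

section \<open>The symmetric product basis\<close>

definition basis :: "nat \<Rightarrow> real \<Rightarrow> real \<Rightarrow> real" where
  "basis l p q = pochhammer (- p) l * pochhammer (- q) l"

lemma basis_0 [simp]: "basis 0 p q = 1"
  by (simp add: basis_def)

lemma basis_Suc: "basis (Suc l) p q = (real l - p) * (real l - q) * basis l p q"
  by (simp add: basis_def pochhammer_Suc algebra_simps)

lemma basis_commute: "basis l p q = basis l q p"
  by (simp add: basis_def)

text \<open>
  The products on the left share all factors except the outermost ones, and the difference of
  the remaining quadratic factors is linear.
\<close>

lemma basis_upward_difference:
  "basis (Suc l) (p + 1) (q - 1) - basis (Suc l) p q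
     = - (real l + 1) * (p - q + 1) * (pochhammer (- p) l * pochhammer (1 - q) l)"
proof -
  have p1: "pochhammer (- (p + 1)) (Suc l) = - (p + 1) * pochhammer (- p) l"
    by (simp add: pochhammer_rec)
  have q1: "pochhammer (- (q - 1)) (Suc l) = pochhammer (1 - q) l * (1 - q + real l)"
    by (simp add: pochhammer_Suc)
  have p0: "pochhammer (- p) (Suc l) = pochhammer (- p) l * (real l - p)"
    by (simp add: pochhammer_Suc)
  have q0: "pochhammer (- q) (Suc l) = - q * pochhammer (1 - q) l"
    by (simp add: pochhammer_rec)
  show ?thesis
    unfolding basis_def p1 q1 p0 q0 by algebra
qed

text \<open>
  The common form of the two recurrence coefficients: \<open>A\<close> is its value at \<open>(m, \<sigma> - m)\<close>, and
  \<open>C\<close> its value at \<open>(\<sigma> - m, m)\<close>.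
\<close>

definition step_weight :: "real \<Rightarrow> real \<Rightarrow> real \<Rightarrow> real \<Rightarrow> real" where
  "step_weight N D p q = (p - N) * (p + D) * (- q) / ((p - q) * (p - q + 1))"

text \<open>
  The factor \<open>p - q + 1\<close> of the denominator of the weight cancels against the difference, and its
  factor \<open>- q\<close> is what turns \<open>(1 - q)\<^sub>l\<close> back into a Pochhammer symbol starting at \<open>- q\<close>.
\<close>

lemma weighted_upward_difference:
  assumes "p - q \<noteq> 0" "p - q + 1 \<noteq> 0"
  shows "step_weight N D p q * (basis (Suc l) (p + 1) (q - 1) - basis (Suc l) p q)
           = - (real l + 1) * (p - N) * (p + D) * (real l - q) / (p - q) * basis l p q"
proof -
  have shift: "- q * pochhammer (1 - q) l = (real l - q) * pochhammer (- q) l"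
    using pochhammer_rec [of "- q" l] pochhammer_Suc [of "- q" l] by (simp add: algebra_simps)
  have "step_weight N D p q * (basis (Suc l) (p + 1) (q - 1) - basis (Suc l) p q)
          = - (real l + 1) * (p - N) * (p + D) / (p - q)
            * pochhammer (- p) l * (- q * pochhammer (1 - q) l)"
    unfolding basis_upward_difference step_weight_def using assms by (simp add: divide_simps)
  then show ?thesis
    unfolding shift basis_def by simp
qed

section \<open>The difference equation for a series in the basis\<close>

text \<open>
  The remainder term follows by evaluating the antisymmetric numerator at \<open>p = l\<close>, where only the
  first weighted difference survives; the coefficient \<open>n + a - l - 1\<close> of the higher product is then
  forced by comparing degrees. It is here that the balancing condition on \<open>p + q\<close> enters.
\<close>

lemma difference_operator_on_basis:
  fixes p q :: real
  assumes nz: "p - q \<noteq> 0" "p - q + 1 \<noteq> 0" "q - p + 1 \<noteq> 0"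
    and balance: "p + q = N + 1 + e - D - n - a"
  shows "step_weight N D p q * (e - p) * (basis (Suc l) (p + 1) (q - 1) - basis (Suc l) p q)
         + step_weight N D q p * (e - q) * (basis (Suc l) (p - 1) (q + 1) - basis (Suc l) p q)
         = (real l + 1) * ((n + a - real l - 1) * basis (Suc l) p q
             + (real l - N) * (real l - e) * (real l + D) * basis l p q)"
    (is "?lhs = ?rhs")
proof -
  have up: "step_weight N D p q * (basis (Suc l) (p + 1) (q - 1) - basis (Suc l) p q)
      = - (real l + 1) * (p - N) * (p + D) * (real l - q) / (p - q) * basis l p q"
    using weighted_upward_difference nz by blast
  have down: "step_weight N D q p * (basis (Suc l) (p - 1) (q + 1) - basis (Suc l) p q)
      = (real l + 1) * (q - N) * (q + D) * (real l - p) / (p - q) * basis l p q"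
  proof -
    have "step_weight N D q p * (basis (Suc l) (q + 1) (p - 1) - basis (Suc l) q p)
        = - (real l + 1) * (q - N) * (q + D) * (real l - p) / (q - p) * basis l q p"
      using weighted_upward_difference [of q p] nz by simp
    moreover have "x / (q - p) = - x / (p - q)" for x
      using minus_divide_divide [of x "p - q"] by (metis minus_diff_eq minus_divide_left minus_divide_right)
    ultimately show ?thesis
      by (simp add: basis_commute [of _ q p] basis_commute [of _ "p - 1"] del: minus_add_distrib)
  qed
  have a: "a = N + 1 + e - D - n - p - q"
    using balance by simp
  have numerator: "(q - N) * (q + D) * (real l - p) * (e - q) - (p - N) * (p + D) * (real l - q) * (e - p)
      = (p - q) * ((n + a - real l - 1) * ((real l - p) * (real l - q))
                   + (real l - N) * (real l - e) * (real l + D))"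
    unfolding a by algebra
  have "?lhs = (e - p) * (- (real l + 1) * (p - N) * (p + D) * (real l - q) / (p - q) * basis l p q)
      + (e - q) * ((real l + 1) * (q - N) * (q + D) * (real l - p) / (p - q) * basis l p q)"
    unfolding up [symmetric] down [symmetric] by (simp add: mult_ac)
  also have "\<dots> = (real l + 1) * basis l p q
      * ((q - N) * (q + D) * (real l - p) * (e - q) - (p - N) * (p + D) * (real l - q) * (e - p)) / (p - q)"
    by (simp add: diff_divide_distrib add_divide_distrib algebra_simps)
  also have "\<dots> = (real l + 1) * basis l p q
      * ((n + a - real l - 1) * ((real l - p) * (real l - q)) + (real l - N) * (real l - e) * (real l + D))"
    unfolding numerator using nz(1) by simp
  also have "\<dots> = ?rhs"
    unfolding basis_Suc by algebra
  finally show ?thesis .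
qed

text \<open>
  With \<open>G l = (l - n) (l - a) c\<^sub>l (-p)\<^sub>l (-q)\<^sub>l\<close>, the recurrence for \<open>c\<close> makes the \<open>l\<close>-th summand of the
  equation equal to \<open>G (l - 1) - G l\<close> for \<open>l \<ge> 1\<close>. The summand for \<open>l = 0\<close> is \<open>- G 0\<close>, and \<open>G n = 0\<close>,
  so there is no boundary contribution.
\<close>

lemma difference_equation_of_series:
  fixes c :: "nat \<Rightarrow> real" and n :: nat and p q :: real
  assumes nz: "p - q \<noteq> 0" "p - q + 1 \<noteq> 0" "q - p + 1 \<noteq> 0"
    and balance: "p + q = N + 1 + e - D - real n - a"
    and recurrence: "\<And>l. l < n \<Longrightarrow>
          (real l + 1) * (real l - N) * (real l - e) * (real l + D) * c (Suc l)
            = (real l - real n) * (real l - a) * c l"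
  defines "V \<equiv> \<lambda>p q. \<Sum>l\<le>n. c l * basis l p q"
  shows "step_weight N D p q * (e - p) * (V (p + 1) (q - 1) - V p q)
         + step_weight N D q p * (e - q) * (V (p - 1) (q + 1) - V p q)
         = a * real n * V p q"
proof -
  define G where "G l = (real l - real n) * (real l - a) * c l * basis l p q" for l
  define s where "s l = step_weight N D p q * (e - p) * (basis l (p + 1) (q - 1) - basis l p q)
      + step_weight N D q p * (e - q) * (basis l (p - 1) (q + 1) - basis l p q)
      - a * real n * basis l p q" for l
  have s_Suc: "c (Suc l) * s (Suc l) = G l - G (Suc l)" if "l < n" for l
  proof -
    have "c (Suc l) * s (Suc l)
        = ((real l + 1) * (real l - N) * (real l - e) * (real l + D) * c (Suc l)) * basis l p q
          + ((real l + 1) * (real n + a - real l - 1) - a * real n) * c (Suc l) * basis (Suc l) p q"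
      unfolding s_def difference_operator_on_basis [OF nz balance] by algebra
    also have "\<dots> = G l - G (Suc l)"
      unfolding recurrence [OF that] G_def of_nat_Suc by algebra
    finally show ?thesis .
  qed
  have "(\<Sum>l\<le>k. c l * s l) = - G k" if "k \<le> n" for k
    using that
  proof (induction k)
    case 0
    then show ?case by (simp add: s_def G_def)
  next
    case (Suc k)
    then show ?case using s_Suc [of k] by simp
  qed
  then have "(\<Sum>l\<le>n. c l * s l) = 0"
    by (simp add: G_def)
  moreover have "(\<Sum>l\<le>n. c l * s l)
      = step_weight N D p q * (e - p) * (V (p + 1) (q - 1) - V p q)
        + step_weight N D q p * (e - q) * (V (p - 1) (q + 1) - V p q) - a * real n * V p q"
    unfolding s_def V_def
    by (simp add: sum_distrib_left sum_distrib_right sum.distrib sum_subtractf algebra_simps)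
  ultimately show ?thesis by simp
qed

section \<open>The functions \<open>U\<close> as series in the basis\<close>

definition series_coeff :: "nat \<Rightarrow> real \<Rightarrow> real \<Rightarrow> real \<Rightarrow> nat \<Rightarrow> nat \<Rightarrow> real" where
  "series_coeff n a b c N l = pochhammer (- real n) l * pochhammer (- a) l / U_den l n a b c N"

text \<open>
  The summation range no longer depends on the degree, because \<open>(-k)\<^sub>l\<close> vanishes for \<open>l > k\<close>; this
  makes it possible to combine the series for three neighbouring degrees term by term.
\<close>

lemma U_eq_series:
  assumes "0 \<le> k" "k \<le> int N"
  shows "U k n a b c N
    = (\<Sum>l\<le>n. series_coeff n a b c N l * basis l (real_of_int k) (2*b + 2*c + 1 - real_of_int k))"
proof -
  have "pochhammer (- real_of_int k) l = 0" if "nat k < l" for l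
    using that assms(1) pochhammer_of_nat_eq_0_lemma [of "nat k" l, where 'a = real] by simp
  then have "(\<Sum>l\<le>n. series_coeff n a b c N l * basis l (real_of_int k) (2*b + 2*c + 1 - real_of_int k))
    = (\<Sum>l = 0..min (nat k) n.
        series_coeff n a b c N l * basis l (real_of_int k) (2*b + 2*c + 1 - real_of_int k))"
    by (intro sum.mono_neutral_right) (auto simp: basis_def)
  also have "\<dots> = U k n a b c N"
    using assms by (auto simp: U_def series_coeff_def basis_def algebra_simps intro!: sum.cong)
  finally show ?thesis by simp
qed

lemma series_coeff_Suc:
  assumes "U_den (Suc l) n a b c N \<noteq> 0"
  shows "(real l + 1) * (real l - real N) * (real l - (real n - a + b))
           * (real l + (real N - 2*a - b - 2*c)) * series_coeff n a b c N (Suc l)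
         = (real l - real n) * (real l - a) * series_coeff n a b c N l"
proof -
  let ?r = "(real l + 1) * (real l - real N) * (real l - (real n - a + b))
              * (real l + (real N - 2*a - b - 2*c))"
  have den: "U_den (Suc l) n a b c N = ?r * U_den l n a b c N"
    by (simp add: U_den_def pochhammer_Suc algebra_simps)
  have num: "pochhammer (- real n) (Suc l) * pochhammer (- a) (Suc l)
      = (real l - real n) * (real l - a) * (pochhammer (- real n) l * pochhammer (- a) l)"
    by (simp add: pochhammer_Suc algebra_simps)
  have "?r \<noteq> 0" using assms den by auto
  then show ?thesis
    unfolding series_coeff_def num den by simp
qed

lemma A_coeff_eq_step_weight:
  "A_coeff m \<alpha> \<beta> \<zeta> N
     = step_weight (real N) (real N - 2*\<alpha> - \<beta> - 2*\<zeta>) (real m) (2*\<beta> + 2*\<zeta> + 1 - real m)"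
  unfolding A_coeff_def A_den_def step_weight_def
  by (intro arg_cong2 [where f = "(/)"]) (simp_all add: algebra_simps)

lemma C_coeff_eq_step_weight:
  "C_coeff m \<alpha> \<beta> \<zeta> N
     = step_weight (real N) (real N - 2*\<alpha> - \<beta> - 2*\<zeta>) (2*\<beta> + 2*\<zeta> + 1 - real m) (real m)"
  unfolding C_coeff_def C_den_def step_weight_def minus_divide_left
  by (intro arg_cong2 [where f = "(/)"]) (simp_all add: algebra_simps)

section \<open>The recurrence relation\<close>

theorem proposition7:
  fixes N m n :: nat and \<alpha> \<beta> \<zeta> :: real
  assumes "N > 0"
    and "generic_parameters \<alpha> \<beta> \<zeta> N"
    and "m \<le> N" and "n \<le> N"
  defines "A \<equiv> A_coeff m \<alpha> \<beta> \<zeta> N"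
    and "C \<equiv> C_coeff m \<alpha> \<beta> \<zeta> N"
    and "u \<equiv> \<lambda>k. U k n \<alpha> \<beta> \<zeta> N"
  shows "real n * (A * u (int m + 1) - (A + C + \<alpha>) * u (int m) + C * u (int m - 1))
       = (real m + \<alpha> - \<beta>) * A * u (int m + 1)
         - ((real m + \<alpha> - \<beta>) * A - (real m - \<alpha> - \<beta> - 2*\<zeta> - 1) * C) * u (int m)
         - (real m - \<alpha> - \<beta> - 2*\<zeta> - 1) * C * u (int m - 1)"
proof -
  define D where "D = real N - 2*\<alpha> - \<beta> - 2*\<zeta>"
  define e where "e = real n - \<alpha> + \<beta>"
  define p where "p = real m"
  define q where "q = 2*\<beta> + 2*\<zeta> + 1 - real m"
  define c where "c = series_coeff n \<alpha> \<beta> \<zeta> N"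
  define V where "V x y = (\<Sum>l\<le>n. c l * basis l x y)" for x y
  have "A_den m \<beta> \<zeta> \<noteq> 0" "C_den m \<beta> \<zeta> \<noteq> 0"
    using assms(2,3) by (auto simp: generic_parameters_def)
  then have nz: "p - q \<noteq> 0" "p - q + 1 \<noteq> 0" "q - p + 1 \<noteq> 0"
    by (auto simp: A_den_def C_den_def p_def q_def)
  \<comment> \<open>Genericity at degree \<open>N\<close> covers every index \<open>l \<le> n\<close>.\<close>
  have den: "U_den l n \<alpha> \<beta> \<zeta> N \<noteq> 0" if "l \<le> n" for l
    using assms(2,4) that by (auto simp: generic_parameters_def)
  have AC: "A = step_weight (real N) D p q" "C = step_weight (real N) D q p"
    unfolding A_def C_def D_def p_def q_def
    by (rule A_coeff_eq_step_weight C_coeff_eq_step_weight)+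
  have equation: "A * (e - p) * (V (p + 1) (q - 1) - V p q)
      + C * (e - q) * (V (p - 1) (q + 1) - V p q) = \<alpha> * real n * V p q"
    unfolding AC V_def
  proof (rule difference_equation_of_series [OF nz])
    show "p + q = real N + 1 + e - D - real n - \<alpha>"
      by (simp add: p_def q_def e_def D_def)
    show "(real l + 1) * (real l - real N) * (real l - e) * (real l + D) * c (Suc l)
        = (real l - real n) * (real l - \<alpha>) * c l" if "l < n" for l
      unfolding c_def e_def D_def using that by (intro series_coeff_Suc den) simp
  qed
  have u_m: "u (int m) = V p q"
    unfolding u_def V_def c_def p_def q_def using assms(3) by (subst U_eq_series) simp_all
  \<comment> \<open>At the two ends of the range of degrees the series \<open>V\<close> and the conventional value 0 of \<open>u\<close>
    may differ, but there the coefficient vanishes.\<close>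
  have u_up: "A * u (int m + 1) = A * V (p + 1) (q - 1)"
  proof (cases "m = N")
    case True
    then have "A = 0" by (simp add: A_def A_coeff_def)
    then show ?thesis by simp
  next
    case False
    then have "u (int m + 1) = V (p + 1) (q - 1)"
      unfolding u_def V_def c_def p_def q_def using assms(3)
      by (subst U_eq_series) (simp_all add: algebra_simps)
    then show ?thesis by simp
  qed
  have u_down: "C * u (int m - 1) = C * V (p - 1) (q + 1)"
  proof (cases "m = 0")
    case True
    then have "C = 0" by (simp add: C_def C_coeff_def)
    then show ?thesis by simp
  next
    case False
    then have "u (int m - 1) = V (p - 1) (q + 1)"
      unfolding u_def V_def c_def p_def q_def using assms(3)
      by (subst U_eq_series) (simp_all add: algebra_simps)
    then show ?thesis by simp
  qed
  have "(e - p) * (A * u (int m + 1)) - (e - p) * A * u (int m)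
      + (e - q) * (C * u (int m - 1)) - (e - q) * C * u (int m) = \<alpha> * real n * u (int m)"
    unfolding u_up u_down u_m using equation by (simp add: algebra_simps)
  then show ?thesis
    unfolding e_def p_def q_def by (simp add: algebra_simps)
qed

end
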